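(* Let $p$ be a prime and let $R$ be a $p$-ring. If $R$ is left $p$-nil or right $p$-nil, then $\Omega_{\{n\}}(R^\circ)=\Omega_n(R^+)$ (as subsets of $R$) for every $n\geq 1$. In particular, $\Omega_n(R^\circ)=\Omega_{\{n\}}(R^\circ)$ for every $n\ge 1$.
   Context: Rings are associative, not necessarily commutative or with identity. A $p$-ring is a ring $R$ whose additive group $R^+$ is a $p$-group (every element has order a power of $p$). The circle operation on $R$ is $x\circ y=x+y+xy$; $R$ is a monoid under $\circ$ with identity $0$, and the adjoint group $R^\circ$ is the group of invertible elements of this monoid. $R$ is left $p$-nil if, for every $x\in R$, $px=0$ (for $p>2$), respectively $4x=0$ (for $p=2$), implies $xy=0$ for all $y\in R$. $R$ is right $p$-nil if its opposite ring is left $p$-nil. For a group $G$, $\Omega_{\{n\}}(G)$ is the set of all $x\in G$ with $x^{p^n}=1$, and $\Omega_n(G)$ is the subgroup generated by $\Omega_{\{n\}}(G)$; thus $\Omega_n(R^+)=\{x\in R: p^nx=0\}$. *)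

theory Defs
  imports "HOL-Computational_Algebra.Primes" "HOL-Algebra.Multiplicative_Group" "HOL-Algebra.Generated_Groups"
begin

text \<open>
  Rings are types of class \<open>ring\<close>: associative, not necessarily commutative and without
  an assumed identity. Groups and monoids attached to a ring are HOL-Algebra records on the
  underlying type.
\<close>

definition additive_group :: "'a::ring monoid" where
  "additive_group = \<lparr>carrier = UNIV, monoid.mult = (+), one = 0\<rparr>"

definition circle :: "'a::ring \<Rightarrow> 'a \<Rightarrow> 'a" where
  "circle x y = x + y + x * y"

definition circle_monoid :: "'a::ring monoid" where
  "circle_monoid = \<lparr>carrier = UNIV, monoid.mult = circle, one = 0\<rparr>"

definition adjoint_group :: "'a::ring monoid" where
  "adjoint_group = units_of circle_monoid"

definition p_group :: "nat \<Rightarrow> 'a monoid \<Rightarrow> bool" where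
  "p_group p G \<longleftrightarrow> group G \<and> (\<forall>x\<in>carrier G. \<exists>k. group.ord G x = p ^ k)"

definition p_ring :: "nat \<Rightarrow> 'a::ring itself \<Rightarrow> bool" where
  "p_ring p _ \<longleftrightarrow> p_group p (additive_group :: 'a monoid)"

text \<open>
  As the ring need not have an identity, the multiple \<open>n x\<close> is the \<open>n\<close>-th power of \<open>x\<close>
  in the additive group.
\<close>

definition nmult :: "nat \<Rightarrow> 'a::ring \<Rightarrow> 'a" where
  "nmult n x = x [^]\<^bsub>additive_group\<^esub> n"

text \<open>
  The product is a parameter, so that the same definition applies to a ring and to its
  opposite, which has the same additive group and the product \<open>\<lambda>x y. y * x\<close>.
\<close>

definition left_p_nil_wrt :: "nat \<Rightarrow> ('a::ring \<Rightarrow> 'a \<Rightarrow> 'a) \<Rightarrow> bool" where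
  "left_p_nil_wrt p m \<longleftrightarrow>
     (\<forall>x. nmult (if p = 2 then 4 else p) x = 0 \<longrightarrow> (\<forall>y. m x y = 0))"

definition left_p_nil :: "nat \<Rightarrow> 'a::ring itself \<Rightarrow> bool" where
  "left_p_nil p _ \<longleftrightarrow> left_p_nil_wrt p (\<lambda>x y :: 'a. x * y)"

definition right_p_nil :: "nat \<Rightarrow> 'a::ring itself \<Rightarrow> bool" where
  "right_p_nil p _ \<longleftrightarrow> left_p_nil_wrt p (\<lambda>x y :: 'a. y * x)"

text \<open>\<open>Omega_set p n G\<close> is $\Omega_{\{n\}}(G)$ and \<open>Omega p n G\<close> is $\Omega_n(G)$.\<close>

definition Omega_set :: "nat \<Rightarrow> nat \<Rightarrow> 'a monoid \<Rightarrow> 'a set" where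
  "Omega_set p n G = {x \<in> carrier G. x [^]\<^bsub>G\<^esub> (p ^ n) = \<one>\<^bsub>G\<^esub>}"

definition Omega :: "nat \<Rightarrow> nat \<Rightarrow> 'a monoid \<Rightarrow> 'a set" where
  "Omega p n G = generate G (Omega_set p n G)"

lemma group_additive_group: "group (additive_group :: 'a::ring monoid)"
  by (rule groupI) (auto simp: additive_group_def add.assoc intro: exI[of _ "- x" for x])

lemma nmult_0 [simp]: "nmult 0 x = 0"
  by (simp add: nmult_def additive_group_def)

lemma nmult_Suc [simp]: "nmult (Suc n) x = nmult n x + x"
  by (simp add: nmult_def additive_group_def nat_pow_def)

lemma monoid_circle_monoid: "monoid (circle_monoid :: 'a::ring monoid)"
  by (rule monoidI) (auto simp: circle_monoid_def circle_def algebra_simps)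

lemma group_adjoint_group: "group (adjoint_group :: 'a::ring monoid)"
  unfolding adjoint_group_def by (rule monoid.units_group[OF monoid_circle_monoid])

lemma Omega_additive_group:
  "Omega p n (additive_group :: 'a::ring monoid) = {x. nmult (p ^ n) x = 0}"
proof -
  interpret A: group "additive_group :: 'a monoid" by (rule group_additive_group)
  have comm: "x \<otimes>\<^bsub>additive_group\<^esub> y = y \<otimes>\<^bsub>additive_group\<^esub> x" for x y :: 'a
    by (simp add: additive_group_def add.commute)
  have set_eq: "Omega_set p n (additive_group :: 'a monoid) = {x. nmult (p ^ n) x = 0}"
    by (auto simp: Omega_set_def nmult_def additive_group_def)
  have carr [simp]: "x \<in> carrier additive_group" for x :: 'a
    by (simp add: additive_group_def)
  have "subgroup (Omega_set p n (additive_group :: 'a monoid)) additive_group"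
    by (rule A.subgroupI)
       (auto simp: Omega_set_def A.nat_pow_inv A.pow_mult_distrib[OF comm] intro!: exI[of _ "\<one>\<^bsub>additive_group\<^esub>"])
  then show ?thesis
    unfolding Omega_def using A.generate_subgroup_incl[of _ "Omega_set p n additive_group"] set_eq
    by (metis (no_types, lifting) generate.incl subset_antisym subset_refl subsetI)
qed

end

theory Submission
  imports Defs
begin

text \<open>
  In the monoid of the circle operation, an \<open>m\<close>-th power expands binomially as
  $x^{\circ m} = \sum_{i \ge 1} \binom{m}{i} x^i$, because $1 + (x \circ y) = (1 + x)(1 + y)$
  in any ring with identity containing the given one. The theorem says that for $m = p^n$ this
  sum vanishes if and only if its linear term $p^n x$ does.

  Let $e = 1$ for odd $p$ and $e = 2$ for $p = 2$. Being \<open>p\<close>-nil on either side makes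
  the additive orders of the powers of \<open>x\<close> drop quickly: if $p^e (c x^i) = 0$ then
  $c x^{i+1} = 0$, as the hypothesis applies to the element $c x^i$. Hence $p^k x = 0$
  implies $p^{k - e(i-1)} x^i = 0$, with the exponent read as $0$ when it is negative. Since $i \binom{p^n}{i}$ is a multiple of $p^n$, the
  coefficient of $x^i$ loses at most $v_p(i)$ factors \<open>p\<close> against $p^n$, and
  $v_p(i) + 1 \le e(i-1)$ for $i \ge 2$; it is here that $p = 2$ needs the stronger hypothesis.
  So the terms with $i \ge 2$ vanish with a factor \<open>p\<close> to spare (\<open>nmult_succ_power_eq_0\<close>), and
  that spare factor is what makes the converse work.

  If $p^n x = 0$, then every term of the expansion vanishes. Conversely, let
  $x^{\circ p^n} = 0$, and let $p^k$ be the additive order of \<open>x\<close>. If $k > n$, then multiplying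
  the expansion by $p^{k-n-1}$ kills all terms but the linear one, which becomes $p^{k-1} x$; so
  $p^{k-1} x = 0$, contrary to the choice of \<open>k\<close>.

  An element with $x^{\circ p^n} = 0$ is invertible, so nothing is lost in passing from the monoid
  to the adjoint group. Finally $\{x. p^n x = 0\}$ is closed under the circle operation, so
  the solutions of $x^{\circ p^n} = 0$ already form a subgroup.
\<close>

section \<open>Multiples and powers in a ring without identity\<close>

lemma nmult_zero_right [simp]: "nmult n 0 = 0"
  by (induction n) auto

lemma nmult_add: "nmult (m + n) x = nmult m x + nmult n x"
  by (induction n) (auto simp: add.assoc)

lemma nmult_add_right: "nmult n (x + y) = nmult n x + nmult n y"
  by (induction n) (auto simp: algebra_simps)

lemma nmult_nmult: "nmult m (nmult n x) = nmult (m * n) x"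
  by (induction m) (auto simp: nmult_add add.commute)

lemma nmult_mult_left: "nmult n (x * y) = nmult n x * y"
  by (induction n) (auto simp: algebra_simps)

lemma nmult_mult_right: "nmult n (x * y) = x * nmult n y"
  by (induction n) (auto simp: algebra_simps)

lemma nmult_sum: "nmult n (\<Sum>i\<in>A. f i) = (\<Sum>i\<in>A. nmult n (f i))"
  by (induction A rule: infinite_finite_induct) (auto simp: nmult_add_right)

lemma nmult_eq_0_dvd:
  assumes "nmult m x = 0" "m dvd n"
  shows "nmult n x = 0"
  using assms by (metis dvdE mult.commute nmult_nmult nmult_zero_right)

text \<open>
  The power $x^{i+1}$. The exponent is shifted because without an identity there is no $x^0$.
\<close>

fun succ_power :: "'a::ring \<Rightarrow> nat \<Rightarrow> 'a" where
  "succ_power x 0 = x"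
| "succ_power x (Suc i) = succ_power x i * x"

lemma succ_power_Suc_left: "succ_power x (Suc i) = x * succ_power x i"
  by (induction i) (auto simp: mult.assoc)

section \<open>Powers for the circle operation\<close>

lemma circle_monoid_simps:
  "carrier circle_monoid = UNIV" "\<one>\<^bsub>circle_monoid\<^esub> = 0"
  "x \<otimes>\<^bsub>circle_monoid\<^esub> y = x + y + x * y"
  by (auto simp: circle_monoid_def circle_def)

lemma adjoint_group_simps:
  "carrier adjoint_group = Units circle_monoid" "\<one>\<^bsub>adjoint_group\<^esub> = 0"
  "x \<otimes>\<^bsub>adjoint_group\<^esub> y = x + y + x * y"
  by (auto simp: adjoint_group_def units_of_def circle_monoid_simps)

lemma pow_adjoint_group:
  "x [^]\<^bsub>adjoint_group\<^esub> (n::nat) = x [^]\<^bsub>circle_monoid\<^esub> n"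
  by (induction n) (auto simp: nat_pow_def adjoint_group_simps circle_monoid_simps)

lemma circle_power_expansion:
  "x [^]\<^bsub>circle_monoid\<^esub> (m::nat) = (\<Sum>i<m. nmult (m choose Suc i) (succ_power x i))"
proof (induction m)
  case 0
  then show ?case by (simp add: nat_pow_def circle_monoid_simps)
next
  case (Suc m)
  let ?P = "\<Sum>i<m. nmult (m choose Suc i) (succ_power x i)"
  have "(\<Sum>i<Suc m. nmult (Suc m choose Suc i) (succ_power x i)) =
      (\<Sum>i<Suc m. nmult (m choose i) (succ_power x i)) +
      (\<Sum>i<Suc m. nmult (m choose Suc i) (succ_power x i))"
    by (simp add: nmult_add sum.distrib del: sum.lessThan_Suc)
  also have "(\<Sum>i<Suc m. nmult (m choose Suc i) (succ_power x i)) = ?P"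
    by (simp add: binomial_eq_0)
  also have "(\<Sum>i<Suc m. nmult (m choose i) (succ_power x i)) = x + ?P * x"
    by (subst sum.lessThan_Suc_shift) (simp add: sum_distrib_right nmult_mult_left)
  also have "x + ?P * x + ?P = x [^]\<^bsub>circle_monoid\<^esub> Suc m"
    using Suc.IH by (simp add: nat_pow_def circle_monoid_simps)
  finally show ?case ..
qed

lemma circle_power_eq_0_imp_Units:
  assumes "x [^]\<^bsub>circle_monoid\<^esub> (m::nat) = 0" "m > 0"
  shows "x \<in> Units circle_monoid"
proof -
  interpret M: monoid "circle_monoid :: 'a monoid" by (rule monoid_circle_monoid)
  obtain l where m: "m = Suc l" using assms(2) by (cases m) auto
  let ?y = "x [^]\<^bsub>circle_monoid\<^esub> l"
  have "?y \<otimes>\<^bsub>circle_monoid\<^esub> x = \<one>\<^bsub>circle_monoid\<^esub>"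
    using assms(1) by (simp add: m circle_monoid_simps(2))
  moreover have "x \<otimes>\<^bsub>circle_monoid\<^esub> ?y = \<one>\<^bsub>circle_monoid\<^esub>"
    using assms(1) M.nat_pow_Suc2[of x l] by (simp add: m circle_monoid_simps)
  ultimately show ?thesis
    unfolding Units_def by (auto simp: circle_monoid_simps(1))
qed

section \<open>Annihilators of powers in a p-nil ring\<close>

text \<open>
  The exponent \<open>e\<close> with which $p^e$ is the annihilator in the definition of \<open>p\<close>-nil.
\<close>

definition nil_exponent :: "nat \<Rightarrow> nat" where
  "nil_exponent p = (if p = 2 then 2 else 1)"

text \<open>
  This is where the left and the right condition merge: powers of \<open>x\<close> commute with \<open>x\<close>, so a
  product can be formed on whichever side the hypothesis controls.
\<close>

lemma p_nil_step:
  fixes x :: "'a::ring"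
  assumes nil: "left_p_nil p TYPE('a) \<or> right_p_nil p TYPE('a)"
    and "nmult (p ^ nil_exponent p * c) (succ_power x i) = 0"
  shows "nmult c (succ_power x (Suc i)) = 0"
proof -
  have "nmult (if p = 2 then 4 else p) (nmult c (succ_power x i)) = 0"
    using assms(2) by (auto simp: nmult_nmult nil_exponent_def split: if_splits)
  with nil have "nmult c (succ_power x i) * x = 0 \<or> x * nmult c (succ_power x i) = 0"
    by (auto simp: left_p_nil_def right_p_nil_def left_p_nil_wrt_def)
  then show ?thesis
    using nmult_mult_left[of c "succ_power x i" x] nmult_mult_right[of c x "succ_power x i"]
      succ_power_Suc_left[of x i] by auto
qed

lemma nmult_succ_power_descent:
  fixes x :: "'a::ring"
  assumes nil: "left_p_nil p TYPE('a) \<or> right_p_nil p TYPE('a)"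
    and x: "nmult (p ^ k) x = 0"
  shows "nmult (p ^ (k - nil_exponent p * i)) (succ_power x i) = 0"
proof (induction i)
  case 0
  then show ?case using x by simp
next
  case (Suc i)
  let ?e = "nil_exponent p"
  have "p ^ (k - ?e * i) dvd p ^ (?e + (k - ?e * Suc i))"
    by (rule le_imp_power_dvd) simp
  with Suc have "nmult (p ^ ?e * p ^ (k - ?e * Suc i)) (succ_power x i) = 0"
    by (metis nmult_eq_0_dvd power_add)
  then show ?case by (rule p_nil_step[OF nil])
qed

text \<open>
  From $p^v \le i + 1$ the linear quantity \<open>v\<close> is compared with an exponential. The bound is
  sharp for $p = 2$, $i = 1$, so $e = 1$ would fail there.
\<close>

lemma valuation_less_nil_exponent:
  assumes "prime p" "p ^ v dvd Suc i" "i \<ge> 1"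
  shows "v + 1 \<le> nil_exponent p * i"
proof (cases v)
  case 0
  then show ?thesis using assms(3) by (simp add: nil_exponent_def)
next
  case (Suc w)
  have le: "p ^ v \<le> Suc i" using assms(2) by (rule dvd_imp_le) simp
  show ?thesis
  proof (cases "p = 2")
    case True
    have "w + 1 \<le> 2 ^ w" by (induction w) auto
    then show ?thesis using le by (simp add: True Suc nil_exponent_def)
  next
    case False
    have "w + 3 \<le> 3 ^ Suc w" by (induction w) auto
    also have "(3::nat) ^ Suc w \<le> p ^ v"
      unfolding Suc using False prime_ge_2_nat[OF assms(1)] by (intro power_mono) auto
    finally show ?thesis using le by (simp add: False Suc nil_exponent_def)
  qed
qed

text \<open>
  Writing $i + 1 = p^v u$ with \<open>u\<close> prime to \<open>p\<close>, the hypothesis on \<open>c\<close> makes it a multiple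
  of $p^{k-1-v}$, and $k - 1 - v \ge k - e i$, which is the exponent supplied by the descent.
\<close>

lemma nmult_succ_power_eq_0:
  fixes x :: "'a::ring"
  assumes p: "prime p"
    and nil: "left_p_nil p TYPE('a) \<or> right_p_nil p TYPE('a)"
    and x: "nmult (p ^ k) x = 0"
    and i: "i \<ge> 1"
    and c: "p ^ (k - 1) dvd Suc i * c"
  shows "nmult c (succ_power x i) = 0"
proof -
  let ?d = "k - nil_exponent p * i"
  obtain v u where u: "Suc i = p ^ v * u" "\<not> p dvd u"
    using multiplicity_decompose'[of "Suc i" p] p
    by (metis Suc_neq_Zero not_prime_unit)
  have v: "v + 1 \<le> nil_exponent p * i"
    using u(1) by (intro valuation_less_nil_exponent[OF p _ i]) simp
  have "coprime (p ^ (k - 1)) u"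
    using p u(2) by (simp add: prime_imp_coprime)
  with c have *: "p ^ (k - 1) dvd p ^ v * c"
    by (metis coprime_dvd_mult_right_iff mult.assoc mult.commute u(1))
  have "p ^ ?d dvd c"
  proof (cases "k \<le> nil_exponent p * i")
    case False
    then have "p ^ (v + ?d) dvd p ^ (k - 1)"
      using v by (intro le_imp_power_dvd) linarith
    then have "p ^ v * p ^ ?d dvd p ^ v * c"
      using * by (metis dvd_trans power_add)
    then show ?thesis using p by (simp add: prime_gt_0_nat)
  qed simp
  then show ?thesis
    using nmult_succ_power_descent[OF nil x] nmult_eq_0_dvd by blast
qed

section \<open>Additive and circle torsion agree\<close>

lemma circle_power_eq_0_iff:
  fixes x :: "'a::ring"
  assumes p: "prime p"
    and pr: "p_ring p TYPE('a)"
    and nil: "left_p_nil p TYPE('a) \<or> right_p_nil p TYPE('a)"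
  shows "x [^]\<^bsub>circle_monoid\<^esub> (p ^ n) = 0 \<longleftrightarrow> nmult (p ^ n) x = 0"
proof -
  let ?t = "\<lambda>i. nmult (p ^ n choose Suc i) (succ_power x i)"
  have "p ^ n > 0" using p by (simp add: prime_gt_0_nat)
  then obtain N where N: "p ^ n = Suc N" by (cases "p ^ n") auto
  have expansion: "x [^]\<^bsub>circle_monoid\<^esub> (p ^ n) = nmult (p ^ n) x + (\<Sum>i<N. ?t (Suc i))"
    by (simp only: circle_power_expansion N sum.lessThan_Suc_shift) simp
  have coeff: "p ^ n dvd Suc i * (p ^ n choose Suc i)" for i
    unfolding N Suc_times_binomial by (rule dvd_triv_left)
  show ?thesis
  proof
    assume x: "nmult (p ^ n) x = 0"
    have "p ^ (n - 1) dvd Suc i * (p ^ n choose Suc i)" for i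
      by (rule dvd_trans[OF le_imp_power_dvd coeff]) simp
    then have "?t (Suc i) = 0" for i
      by (rule nmult_succ_power_eq_0[OF p nil x, rotated]) simp
    with x show "x [^]\<^bsub>circle_monoid\<^esub> (p ^ n) = 0"
      by (simp add: expansion)
  next
    assume 0: "x [^]\<^bsub>circle_monoid\<^esub> (p ^ n) = 0"
    interpret A: group "additive_group :: 'a monoid" by (rule group_additive_group)
    have "x \<in> carrier additive_group"
      by (simp add: additive_group_def)
    then obtain k\<^sub>0 where "A.ord x = p ^ k\<^sub>0"
      using pr by (auto simp: p_ring_def p_group_def)
    with A.pow_ord_eq_1[of x] \<open>x \<in> carrier additive_group\<close> have "nmult (p ^ k\<^sub>0) x = 0"
      by (simp add: nmult_def additive_group_def)
    define k where "k = (LEAST k. nmult (p ^ k) x = 0)"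
    have k: "nmult (p ^ k) x = 0"
      unfolding k_def by (rule LeastI) fact
    have "k \<le> n"
    proof (rule ccontr)
      assume "\<not> k \<le> n"
      then have "k > n" by simp
      define s where "s = p ^ (k - n - 1)"
      have s: "s * p ^ n = p ^ (k - 1)"
        unfolding s_def power_add[symmetric] using \<open>k > n\<close> by simp
      have "nmult s (?t (Suc i)) = 0" for i
      proof -
        have "p ^ (k - 1) dvd Suc (Suc i) * (s * (p ^ n choose Suc (Suc i)))"
          using mult_dvd_mono[OF dvd_refl[of s] coeff[of "Suc i"]] by (simp only: s mult.left_commute)
        then show ?thesis
          unfolding nmult_nmult by (intro nmult_succ_power_eq_0[OF p nil k]) auto
      qed
      then have "nmult (p ^ (k - 1)) x = nmult s (x [^]\<^bsub>circle_monoid\<^esub> (p ^ n))"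
        by (simp add: expansion nmult_add_right nmult_sum nmult_nmult s)
      then have "nmult (p ^ (k - 1)) x = 0"
        by (simp add: 0)
      then have "k \<le> k - 1"
        unfolding k_def by (rule Least_le)
      with \<open>k > n\<close> show False by simp
    qed
    then show "nmult (p ^ n) x = 0"
      using k nmult_eq_0_dvd le_imp_power_dvd by blast
  qed
qed

theorem theoremA:
  fixes p :: nat
  assumes "prime p"
    and "p_ring p TYPE('a::ring)"
    and "left_p_nil p TYPE('a) \<or> right_p_nil p TYPE('a)"
  shows "(\<forall>n\<ge>1. Omega_set p n (adjoint_group :: 'a monoid) = Omega p n (additive_group :: 'a monoid)) \<and>
         (\<forall>n\<ge>1. Omega p n (adjoint_group :: 'a monoid) = Omega_set p n (adjoint_group :: 'a monoid))"
proof -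
  interpret G: group "adjoint_group :: 'a monoid" by (rule group_adjoint_group)
  have pos: "p ^ n > 0" for n
    using assms(1) by (simp add: prime_gt_0_nat)
  have torsion: "Omega_set p n adjoint_group = {x :: 'a. nmult (p ^ n) x = 0}" for n
    using circle_power_eq_0_imp_Units[OF _ pos] circle_power_eq_0_iff[OF assms]
    by (auto simp: Omega_set_def pow_adjoint_group adjoint_group_simps)
  have "subgroup (Omega_set p n (adjoint_group :: 'a monoid)) adjoint_group" for n
  proof (rule G.subgroupI)
    show "Omega_set p n (adjoint_group :: 'a monoid) \<subseteq> carrier adjoint_group"
      by (auto simp: Omega_set_def)
    show "Omega_set p n (adjoint_group :: 'a monoid) \<noteq> {}"
      unfolding torsion by (auto intro: exI[of _ 0])
  next
    fix a :: 'a assume "a \<in> Omega_set p n adjoint_group"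
    then show "inv\<^bsub>adjoint_group\<^esub> a \<in> Omega_set p n adjoint_group"
      by (auto simp: Omega_set_def G.nat_pow_inv)
  next
    fix a b :: 'a
    assume "a \<in> Omega_set p n adjoint_group" "b \<in> Omega_set p n adjoint_group"
    then show "a \<otimes>\<^bsub>adjoint_group\<^esub> b \<in> Omega_set p n adjoint_group"
      unfolding torsion adjoint_group_simps(3) by (simp add: nmult_add_right nmult_mult_left)
  qed
  then have "Omega p n (adjoint_group :: 'a monoid) = Omega_set p n adjoint_group" for n
    unfolding Omega_def
    by (intro equalityI G.generate_subgroup_incl) (auto intro: generate.incl)
  then show ?thesis
    by (simp add: torsion Omega_additive_group)
qed

end
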